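(* For every pair $(\alpha,\beta)$ of elements of a quadratic number field $K$, there exist four non-collinear points $A,B,C,D\in\mathbb{Z}^2$ such that $$\begin{pmatrix}0\\0\end{pmatrix}=(1-\alpha)\big((1-\beta)A+\beta B\big)+\alpha\big((1-\beta)C+\beta D\big).\qquad( * )$$ Moreover, such points $A,B,C,D$ (non-collinear, in $\mathbb{Z}^2$, satisfying $( * )$) can be chosen so that opposite sides of the quadrilateral $ABDC$ are not parallel (i.e. $AB$ and $CD$ are not parallel, and $AC$ and $BD$ are not parallel) if and only if $\alpha$ and $\beta$ are both irrational or both rational.
   Context: A quadratic number field is $K=\mathbb{Q}(\sqrt d)$ for a square-free integer $d\ne0,1$. Points are non-collinear if they do not all lie on one line. Two vectors are parallel if their span is at most one-dimensional (so the zero vector is parallel to every vector); segments $XY$ and $ZT$ are parallel if $X-Y$ and $Z-T$ are parallel. *)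

theory Defs
  imports "HOL-Analysis.Analysis" "HOL-Algebra.Algebraic_Closure_Type"
    "HOL-Algebra.Generated_Fields"
begin

unbundle no fps_syntax

text \<open>
  The field \<open>\<rat>(\<surd>d)\<close>, as the subfield of \<open>\<complex>\<close> generated by a square root of \<open>d\<close>; it does
  not depend on which of the two roots is used. It contains \<open>\<rat>\<close> because \<open>\<complex>\<close> has
  characteristic zero.
\<close>

definition rat_adjoin_sqrt :: "int \<Rightarrow> complex set" where
  "rat_adjoin_sqrt d = generate_field ring_of_type_algebra {csqrt (of_int d)}"

definition quadratic_number_field :: "complex set \<Rightarrow> bool" where
  "quadratic_number_field K \<longleftrightarrow>
     (\<exists>d. squarefree d \<and> d \<noteq> 0 \<and> d \<noteq> 1 \<and> K = rat_adjoin_sqrt d)"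

definition vec_of_int :: "int ^ 'n \<Rightarrow> 'a::ring_1 ^ 'n" where
  "vec_of_int v = (\<chi> i. of_int (v $ i))"

text \<open>The points need not be distinct: for \<open>\<alpha> = 0\<close> and irrational \<open>\<beta>\<close>, the equation
  in \<open>zero_combination\<close> forces \<open>A = B = 0\<close>.\<close>

definition non_collinear :: "int ^ 2 \<Rightarrow> int ^ 2 \<Rightarrow> int ^ 2 \<Rightarrow> int ^ 2 \<Rightarrow> bool" where
  "non_collinear A B C D \<longleftrightarrow>
     \<not> collinear {vec_of_int A, vec_of_int B, vec_of_int C, vec_of_int D :: real ^ 2}"

definition parallel_vectors :: "real ^ 2 \<Rightarrow> real ^ 2 \<Rightarrow> bool" where
  "parallel_vectors u v \<longleftrightarrow> dim (span {u, v}) \<le> 1"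

definition parallel_segments :: "int ^ 2 \<Rightarrow> int ^ 2 \<Rightarrow> int ^ 2 \<Rightarrow> int ^ 2 \<Rightarrow> bool" where
  "parallel_segments x y z t \<longleftrightarrow>
     parallel_vectors (vec_of_int x - vec_of_int y) (vec_of_int z - vec_of_int t)"

definition zero_combination ::
    "complex \<Rightarrow> complex \<Rightarrow> int ^ 2 \<Rightarrow> int ^ 2 \<Rightarrow> int ^ 2 \<Rightarrow> int ^ 2 \<Rightarrow> bool" where
  "zero_combination \<alpha> \<beta> A B C D \<longleftrightarrow>
     0 = (1 - \<alpha>) *s ((1 - \<beta>) *s vec_of_int A + \<beta> *s vec_of_int B)
       + \<alpha> *s ((1 - \<beta>) *s vec_of_int C + \<beta> *s vec_of_int D)"

lemma rat_adjoin_sqrt_eq: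
  "rat_adjoin_sqrt d = {x + y * csqrt (of_int d) | x y. x \<in> \<rat> \<and> y \<in> \<rat>}"
proof -
  let ?R = "ring_of_type_algebra :: complex ring"
  let ?s = "csqrt (of_int d)"
  let ?G = "generate_field ?R {?s}"
  let ?S = "{x + y * ?s | x y. x \<in> \<rat> \<and> y \<in> \<rat>}"
  interpret field ?R
    by (rule field_from_type_algebra)
  have carr [simp]: "carrier ?R = UNIV" and one [simp]: "\<one>\<^bsub>?R\<^esub> = 1"
    and zero [simp]: "\<zero>\<^bsub>?R\<^esub> = 0" and add [simp]: "x \<oplus>\<^bsub>?R\<^esub> y = x + y"
    and mult [simp]: "x \<otimes>\<^bsub>?R\<^esub> y = x * y" for x y
    by (simp_all add: ring_of_type_algebra_def)
  have neg [simp]: "\<ominus>\<^bsub>?R\<^esub> x = - x" for x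
    using minus_equality[of "- x" x] by simp
  have inv_eq: "inv\<^bsub>?R\<^esub> x = inverse x" if "x \<noteq> 0" for x
    using inv_char[of x "inverse x"] that by simp
  have s2: "?s * ?s = of_int d"
    by (metis power2_csqrt power2_eq_square)
  have SI: "x + y * ?s \<in> ?S" if "x \<in> \<rat>" "y \<in> \<rat>" for x y
    using that by blast
  have Sinv: "inverse (x + y * ?s) \<in> ?S" if xy: "x \<in> \<rat>" "y \<in> \<rat>" for x y
  proof (cases "x - y * ?s = 0")
    case True
    show ?thesis
    proof (cases "y = 0")
      case True
      then show ?thesis using SI[of "inverse x" 0] xy by simp
    next
      case False
      with True have "?s = x / y" by (simp add: field_simps)
      then have "inverse (x + y * ?s) \<in> \<rat>" using xy by auto
      then show ?thesis using SI[of "inverse (x + y * ?s)" 0] by simp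
    qed
  next
    case False
    define n where "n = x * x - y * y * of_int d"
    have n: "n \<in> \<rat>" using xy by (auto simp: n_def)
    have n_eq: "n = (x + y * ?s) * (x - y * ?s)"
      using s2 by (simp add: n_def algebra_simps)
    have "inverse u = v / (u * v)" if "v \<noteq> 0" for u v :: complex
      using that by (simp add: divide_inverse)
    from this[OF False] have "inverse (x + y * ?s) = (x - y * ?s) / n"
      unfolding n_eq .
    also have "\<dots> = x / n + (- y / n) * ?s"
      by (simp add: diff_divide_distrib)
    finally show ?thesis using SI[of "x / n" "- y / n"] xy n by simp
  qed
  have "z \<in> ?S" if "z \<in> ?G" for z
    using that
  proof induction
    case one
    show ?case using SI[of 1 0] by simp
  next
    case (incl h)
    then show ?case using SI[of 0 1] by simp
  next
    case (a_inv h)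
    then obtain x y where "h = x + y * ?s" "x \<in> \<rat>" "y \<in> \<rat>" by blast
    then show ?case using SI[of "- x" "- y"] by simp
  next
    case (m_inv h)
    then obtain x y where h: "h = x + y * ?s" "x \<in> \<rat>" "y \<in> \<rat>" by blast
    have "h \<noteq> 0" using m_inv.hyps by simp
    then have "inv\<^bsub>?R\<^esub> h = inverse (x + y * ?s)" using inv_eq[of h] h(1) by simp
    with Sinv[OF h(2,3)] show ?case by (simp only:)
  next
    case (eng_add h1 h2)
    then obtain x y u v where "h1 = x + y * ?s" "x \<in> \<rat>" "y \<in> \<rat>"
      "h2 = u + v * ?s" "u \<in> \<rat>" "v \<in> \<rat>" by blast
    then show ?case using SI[of "x + u" "y + v"] by (simp add: algebra_simps)
  next
    case (eng_mult h1 h2)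
    then obtain x y u v where h: "h1 = x + y * ?s" "x \<in> \<rat>" "y \<in> \<rat>"
      "h2 = u + v * ?s" "u \<in> \<rat>" "v \<in> \<rat>" by blast
    have "h1 * h2 = (x * u + y * v * (?s * ?s)) + (x * v + y * u) * ?s"
      by (simp add: h algebra_simps)
    then show ?case using SI[of "x * u + y * v * of_int d" "x * v + y * u"] h s2 by simp
  qed
  moreover have "z \<in> ?G" if "z \<in> ?S" for z
  proof -
    have add': "a + b \<in> ?G" and mult': "a * b \<in> ?G" if "a \<in> ?G" "b \<in> ?G" for a b
      using generate_field.eng_add[OF that] generate_field.eng_mult[OF that] by simp_all
    have one': "1 \<in> ?G" using generate_field.one[of ?R] by simp
    have neg': "- a \<in> ?G" if "a \<in> ?G" for a
      using generate_field.a_inv[OF that] by simp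
    have zero': "0 \<in> ?G" using add'[OF one' neg'[OF one']] by simp
    have inv': "inverse a \<in> ?G" if "a \<in> ?G" for a
      using generate_field.m_inv[OF that] zero' inv_eq[of a] by (cases "a = 0") auto
    have nat': "of_nat n \<in> ?G" for n
      by (induction n) (use zero' one' add' in auto)
    have int': "of_int n \<in> ?G" for n
      by (cases n) (use nat' neg' in \<open>auto simp del: of_nat_Suc\<close>)
    have rat': "x \<in> ?G" if "x \<in> \<rat>" for x
    proof -
      obtain a b where "x = of_int a / of_int b"
        using \<open>x \<in> \<rat>\<close> by (rule Rats_cases')
      then show ?thesis using mult'[OF int' inv'[OF int']] by (simp add: divide_inverse)
    qed
    obtain x y where z: "z = x + y * ?s" "x \<in> \<rat>" "y \<in> \<rat>"
      using \<open>z \<in> ?S\<close> by blast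
    have "?s \<in> ?G" by (rule generate_field.incl) simp
    from add'[OF rat'[OF z(2)] mult'[OF rat'[OF z(3)] this]] show ?thesis
      unfolding z(1) .
  qed
  ultimately show ?thesis unfolding rat_adjoin_sqrt_def by blast
qed

end

(*
  Expanding (1-\<alpha>)((1-\<beta>)A + \<beta>B) + \<alpha>((1-\<beta>)C + \<beta>D) at A turns the equation into
  A + \<beta>U + \<alpha>V + \<alpha>\<beta>W = 0 with U = B - A, V = C - A, W = A - B - C + D.
  If \<alpha> and \<beta> are rational, then U, V, W can be chosen freely and A is computed from them.
  If both are irrational, then K = \<rat> + \<rat>\<alpha>, so \<beta> = l + k\<alpha> with k \<noteq> 0 and
  \<alpha>\<beta> = h + g\<alpha>; now U and W are free, and A = -lU - hW, V = -kU - gW is a solution.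
  If only \<beta> is irrational, the equation splits into (1-\<alpha>)A + \<alpha>C = 0 = (1-\<alpha>)B + \<alpha>D, so AB
  and CD are parallel. Denominators are cleared by scaling.
*)
theory Submission
  imports Defs
begin

section \<open>Rational coefficients and the field K\<close>

text \<open>The vector equation is homogeneous, so a rational solution scaled by such an
  \<open>N\<close> becomes an integral one.\<close>

lemma finite_Rats_common_denominator:
  fixes S :: "'a::field_char_0 set"
  assumes "finite S" "S \<subseteq> \<rat>"
  obtains N :: int where "N \<noteq> 0" "\<And>x. x \<in> S \<Longrightarrow> of_int N * x \<in> \<int>"
proof -
  have "\<exists>N::int. N \<noteq> 0 \<and> (\<forall>x\<in>S. of_int N * x \<in> \<int>)"
    using assms
  proof (induction S rule: finite_induct)
    case empty
    show ?case by (intro exI[of _ 1]) simp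
  next
    case (insert x S)
    then obtain N :: int where N: "N \<noteq> 0" "\<forall>y\<in>S. of_int N * y \<in> \<int>"
      by auto
    from insert.prems have "x \<in> \<rat>" by simp
    then obtain a b where "b > 0" and x: "x = of_int a / of_int b"
      by (rule Rats_cases')
    then have ab: "b \<noteq> 0" "x = of_int a / of_int b" by simp_all
    have "of_int (N * b) * x = of_int (N * a)"
      using ab by simp
    then have "of_int (N * b) * x \<in> \<int>"
      by (simp only: Ints_of_int)
    moreover have "of_int (N * b) * y \<in> \<int>" if "y \<in> S" for y
    proof -
      have "of_int b * (of_int N * y) \<in> \<int>"
        using that N by auto
      then show ?thesis by (simp add: mult_ac)
    qed
    ultimately show ?case
      using N ab by (intro exI[of _ "N * b"]) auto
  qed
  then show thesis using that by blast
qed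

text \<open>The field has dimension two over the rationals. Irrationality of \<alpha> makes its
  coefficient at the square root nonzero, so the root can be solved for in terms of 1 and
  \<alpha>.\<close>

lemma rat_adjoin_sqrt_irrational_basis:
  assumes "\<alpha> \<in> rat_adjoin_sqrt d" "\<alpha> \<notin> \<rat>" "z \<in> rat_adjoin_sqrt d"
  obtains x y where "x \<in> \<rat>" "y \<in> \<rat>" "z = x + y * \<alpha>"
proof -
  obtain a b where a: "\<alpha> = a + b * csqrt (of_int d)" "a \<in> \<rat>" "b \<in> \<rat>"
    using assms(1) unfolding rat_adjoin_sqrt_eq by blast
  obtain u v where z: "z = u + v * csqrt (of_int d)" "u \<in> \<rat>" "v \<in> \<rat>"
    using assms(3) unfolding rat_adjoin_sqrt_eq by blast
  have "b \<noteq> 0" using assms(2) a by auto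
  then have "z = (u - v / b * a) + v / b * \<alpha>"
    by (simp add: a z algebra_simps)
  with a z show thesis
    by (intro that[of "u - v / b * a" "v / b"]) auto
qed

lemma quadratic_number_field_mult:
  assumes "quadratic_number_field K" "x \<in> K" "y \<in> K"
  shows "x * y \<in> K"
proof -
  from assms(1) obtain d where K: "K = rat_adjoin_sqrt d"
    unfolding quadratic_number_field_def by blast
  show ?thesis
    using generate_field.eng_mult[of x "ring_of_type_algebra" _ y] assms(2,3)
    unfolding K rat_adjoin_sqrt_def by (simp add: ring_of_type_algebra_def)
qed

section \<open>Parallelism and collinearity\<close>

text \<open>The vanishing determinant replaces the dimension, so that parallelism of integer
  segments becomes an integer equation.\<close>

lemma parallel_vectors_iff: "parallel_vectors u v \<longleftrightarrow> u $ 1 * v $ 2 = u $ 2 * v $ 1"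
proof
  assume det: "u $ 1 * v $ 2 = u $ 2 * v $ 1"
  \<comment> \<open>The spanning vector is \<open>u\<close>, or \<open>v\<close> if \<open>u\<close>
    vanishes.\<close>
  have "\<exists>w. {u, v} \<subseteq> span {w}"
  proof (cases "u = 0")
    case True
    then show ?thesis by (intro exI[of _ v]) (simp add: span_base span_zero)
  next
    case False
    have "\<exists>c. v = c *\<^sub>R u"
    proof (cases "u $ 1 = 0")
      case True
      with False have "u $ 2 \<noteq> 0"
        by (simp add: vec_eq_iff forall_2)
      with True det show ?thesis
        by (intro exI[of _ "v $ 2 / u $ 2"]) (simp add: vec_eq_iff forall_2)
    next
      case False
      with det show ?thesis
        by (intro exI[of _ "v $ 1 / u $ 1"]) (simp add: vec_eq_iff forall_2 field_simps)
    qed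
    then show ?thesis
      by (intro exI[of _ u]) (auto simp: span_base span_scale)
  qed
  then obtain w where "{u, v} \<subseteq> span {w}" by blast
  then have "dim {u, v} \<le> dim {w}"
    by (metis dim_span dim_subset)
  also have "dim {w} \<le> card {w}"
    by (rule dim_le_card') simp
  finally show "parallel_vectors u v"
    by (simp add: parallel_vectors_def)
next
  assume par: "parallel_vectors u v"
  show "u $ 1 * v $ 2 = u $ 2 * v $ 1"
  proof (rule ccontr)
    assume det: "u $ 1 * v $ 2 \<noteq> u $ 2 * v $ 1"
    then have "u \<noteq> v" "v \<noteq> 0" by (auto simp: mult.commute)
    moreover have "u \<notin> span {v}"
      using det by (auto simp: span_singleton)
    ultimately have "independent {u, v}"
      by (simp add: independent_insert)
    then have "dim {u, v} = 2"
      using \<open>u \<noteq> v\<close> by (simp add: dim_eq_card_independent)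
    with par show False by (simp add: parallel_vectors_def)
  qed
qed

lemma parallel_segments_iff:
  "parallel_segments x y z t \<longleftrightarrow>
     (x $ 1 - y $ 1) * (z $ 2 - t $ 2) = (x $ 2 - y $ 2) * (z $ 1 - t $ 1)"
proof -
  have "parallel_segments x y z t \<longleftrightarrow>
      real_of_int ((x $ 1 - y $ 1) * (z $ 2 - t $ 2)) = of_int ((x $ 2 - y $ 2) * (z $ 1 - t $ 1))"
    by (simp add: parallel_segments_def parallel_vectors_iff vec_of_int_def)
  then show ?thesis by (simp only: of_int_eq_iff)
qed

lemma collinear_imp_parallel_vectors:
  assumes "collinear S" "a \<in> S" "b \<in> S" "c \<in> S" "d \<in> S"
  shows "parallel_vectors (a - b) (c - d)"
proof -
  from assms obtain w r s where "a - b = r *\<^sub>R w" "c - d = s *\<^sub>R w"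
    unfolding collinear_def by blast
  then show ?thesis by (simp add: parallel_vectors_iff)
qed

text \<open>Differences of points on one line are multiples of one direction. Hence the
  quadrilaterals built below need no separate check of non-collinearity.\<close>

lemma non_collinearI:
  assumes "\<not> parallel_segments A B C D"
  shows "non_collinear A B C D"
  using assms collinear_imp_parallel_vectors
  unfolding non_collinear_def parallel_segments_def by blast

section \<open>Forms and symmetry of the equation\<close>

lemma zero_combination_iff:
  "zero_combination \<alpha> \<beta> A B C D \<longleftrightarrow>
     (\<forall>i. (1 - \<alpha>) * ((1 - \<beta>) * of_int (A $ i) + \<beta> * of_int (B $ i))
        + \<alpha> * ((1 - \<beta>) * of_int (C $ i) + \<beta> * of_int (D $ i)) = 0)"
  by (auto simp: zero_combination_def vec_eq_iff vec_of_int_def algebra_simps)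

text \<open>\<open>W\<close> is the defect of the quadrilateral from a parallelogram: its sides are
  \<open>U\<close> and \<open>U + W\<close>, \<open>V\<close> and \<open>V + W\<close>. Opposite
  sides are therefore parallel exactly when \<open>U\<close>, respectively \<open>V\<close>, is
  parallel to \<open>W\<close>.\<close>

lemma zero_combination_edges:
  fixes A U V W :: "int ^ 2"
  assumes "\<And>i. of_int (A $ i) + \<beta> * of_int (U $ i) + \<alpha> * of_int (V $ i)
    + \<alpha> * \<beta> * of_int (W $ i) = 0"
  shows "zero_combination \<alpha> \<beta> A (A + U) (A + V) (A + U + V + W)"
  unfolding zero_combination_iff
proof
  fix i
  show "(1 - \<alpha>) * ((1 - \<beta>) * of_int (A $ i) + \<beta> * of_int ((A + U) $ i))
      + \<alpha> * ((1 - \<beta>) * of_int ((A + V) $ i) + \<beta> * of_int ((A + U + V + W) $ i)) = 0"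
    using assms[of i] by (simp add: algebra_simps)
qed

text \<open>This symmetry exchanges the two pairs of opposite sides, so only one of the two mixed
  cases needs a proof.\<close>

lemma zero_combination_swap:
  "zero_combination \<alpha> \<beta> A B C D \<longleftrightarrow> zero_combination \<beta> \<alpha> A C B D"
  unfolding zero_combination_iff by (simp add: algebra_simps)

lemma non_collinear_swap: "non_collinear A B C D \<longleftrightarrow> non_collinear A C B D"
  by (simp add: non_collinear_def insert_commute)

section \<open>The cases of rational and irrational parameters\<close>

lemma rational_irrational_parallel:
  assumes "\<alpha> \<in> \<rat>" "\<beta> \<notin> \<rat>" and zero: "zero_combination \<alpha> \<beta> A B C D"
  shows "parallel_segments A B C D"
proof -
  have edge: "(1 - \<alpha>) * of_int (A $ i - B $ i) + \<alpha> * of_int (C $ i - D $ i) = 0" for i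
  proof -
    define p where "p = (1 - \<alpha>) * of_int (A $ i) + \<alpha> * of_int (C $ i)"
    define q where "q = (1 - \<alpha>) * of_int (B $ i) + \<alpha> * of_int (D $ i)"
    have "p \<in> \<rat>" "q \<in> \<rat>" using assms(1) by (auto simp: p_def q_def)
    \<comment> \<open>In each coordinate the equation reads (1 - \<beta>)p + \<beta>q = 0 with
      rational p and q; if they differed, \<beta> would be rational.\<close>
    have eq: "\<beta> * (p - q) = p"
      using zero unfolding zero_combination_iff p_def q_def
      by (auto simp: algebra_simps dest!: spec[of _ i])
    have "p = q"
    proof (rule ccontr)
      assume "p \<noteq> q"
      with eq have "\<beta> = p / (p - q)" by (simp add: field_simps)
      with \<open>p \<in> \<rat>\<close> \<open>q \<in> \<rat>\<close> assms(2) show False by auto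
    qed
    then show ?thesis by (simp add: p_def q_def algebra_simps)
  qed
  define u where "u i = complex_of_int (A $ i - B $ i)" for i
  define v where "v i = complex_of_int (C $ i - D $ i)" for i
  have e: "(1 - \<alpha>) * u i + \<alpha> * v i = 0" for i
    using edge by (simp add: u_def v_def)
  \<comment> \<open>The weights 1 - \<alpha> and \<alpha> add up to 1, so the determinant is a
    combination of the two vanishing sums, without a case split on \<alpha> = 0.\<close>
  have "u 1 * v 2 - u 2 * v 1
      = ((1 - \<alpha>) * u 1 + \<alpha> * v 1) * (v 2 - u 2) - ((1 - \<alpha>) * u 2 + \<alpha> * v 2) * (v 1 - u 1)"
    by (simp add: algebra_simps)
  then have "u 1 * v 2 = u 2 * v 1" by (simp add: e)
  then show ?thesis
    unfolding u_def v_def parallel_segments_iff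
    by (simp only: of_int_mult[symmetric] of_int_eq_iff)
qed

lemma rational_exists_non_collinear:
  assumes "\<alpha> \<in> \<rat>"
  shows "\<exists>A B C D. non_collinear A B C D \<and> zero_combination \<alpha> \<beta> A B C D"
proof -
  obtain m n :: int where "n > 0" and \<alpha>: "\<alpha> = of_int m / of_int n"
    using assms by (rule Rats_cases')
  then have n: "n \<noteq> 0" "\<alpha> = of_int m / of_int n" by simp_all
  \<comment> \<open>A and C lie on the first axis, B and D on the second, chosen so that (1 -
    \<alpha>)A + \<alpha>C and (1 - \<alpha>)B + \<alpha>D both vanish; this settles every \<beta>.
    AC and BD are perpendicular and nonzero.\<close>
  define A B C D :: "int ^ 2" where
    "A = vector [m, 0]" "B = vector [0, m]" "C = vector [m - n, 0]" "D = vector [0, m - n]"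
  have "zero_combination \<alpha> \<beta> A B C D"
    using n unfolding zero_combination_iff A_B_C_D_def by (simp add: forall_2 field_simps)
  moreover have "non_collinear A C B D"
    by (rule non_collinearI) (use n in \<open>simp add: parallel_segments_iff A_B_C_D_def\<close>)
  ultimately show ?thesis using non_collinear_swap by blast
qed

lemma both_rational_non_parallel:
  assumes "\<alpha> \<in> \<rat>" "\<beta> \<in> \<rat>"
  shows "\<exists>A B C D. zero_combination \<alpha> \<beta> A B C D \<and>
    \<not> parallel_segments A B C D \<and> \<not> parallel_segments A C B D"
proof -
  obtain N :: int where N: "N \<noteq> 0"
    and Ints: "\<And>x. x \<in> {\<beta> + \<alpha> * \<beta>, \<alpha> + \<alpha> * \<beta>} \<Longrightarrow> of_int N * x \<in> \<int>"
    by (rule finite_Rats_common_denominator[of "{\<beta> + \<alpha> * \<beta>, \<alpha> + \<alpha> * \<beta>}"]) (use assms in auto)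
  obtain a b :: int where ab: "of_int N * (\<beta> + \<alpha> * \<beta>) = of_int a" "of_int N * (\<alpha> + \<alpha> * \<beta>) = of_int b"
    using Ints by (metis Ints_cases insertCI)
  \<comment> \<open>The diagonal vector \<open>W\<close> is parallel to neither axis vector
    \<open>U\<close>, \<open>V\<close>; \<open>A\<close> is then forced by the equation.\<close>
  define A U V W :: "int ^ 2" where
    "A = vector [- a, - b]" "U = vector [N, 0]" "V = vector [0, N]" "W = vector [N, N]"
  have "zero_combination \<alpha> \<beta> A (A + U) (A + V) (A + U + V + W)"
  proof (rule zero_combination_edges)
    fix i :: 2
    show "of_int (A $ i) + \<beta> * of_int (U $ i) + \<alpha> * of_int (V $ i) + \<alpha> * \<beta> * of_int (W $ i) = 0"
      using ab[symmetric] exhaust_2[of i] by (auto simp: A_U_V_W_def algebra_simps)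
  qed
  moreover have "\<not> parallel_segments A (A + U) (A + V) (A + U + V + W)"
    "\<not> parallel_segments A (A + V) (A + U) (A + U + V + W)"
    using N by (simp_all add: parallel_segments_iff A_U_V_W_def)
  ultimately show ?thesis by blast
qed

lemma both_irrational_non_parallel:
  assumes "quadratic_number_field K" "\<alpha> \<in> K" "\<beta> \<in> K" "\<alpha> \<notin> \<rat>" "\<beta> \<notin> \<rat>"
  shows "\<exists>A B C D. zero_combination \<alpha> \<beta> A B C D \<and>
    \<not> parallel_segments A B C D \<and> \<not> parallel_segments A C B D"
proof -
  have K: "\<exists>x y. x \<in> \<rat> \<and> y \<in> \<rat> \<and> z = x + y * \<alpha>" if "z \<in> K" for z
    using assms that rat_adjoin_sqrt_irrational_basis
    unfolding quadratic_number_field_def by metis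
  obtain l k where lk: "l \<in> \<rat>" "k \<in> \<rat>" "\<beta> = l + k * \<alpha>"
    using K[OF assms(3)] by blast
  have "\<alpha> * \<beta> \<in> K"
    using quadratic_number_field_mult assms by blast
  then obtain h g where hg: "h \<in> \<rat>" "g \<in> \<rat>" "\<alpha> * \<beta> = h + g * \<alpha>"
    using K by blast
  \<comment> \<open>Irrationality of \<beta> enters here: the first coordinate of \<open>V\<close>
    will be -Nk, which keeps \<open>V\<close> from being parallel to \<open>W\<close>.\<close>
  have "k \<noteq> 0" using lk assms(5) by auto
  obtain N :: int where N: "N \<noteq> 0"
    and Ints: "\<And>x. x \<in> {l, k, h, g} \<Longrightarrow> of_int N * x \<in> \<int>"
    by (rule finite_Rats_common_denominator[of "{l, k, h, g}"]) (use lk hg in auto)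
  obtain l' k' h' g' :: int
    where ints: "of_int N * l = of_int l'" "of_int N * k = of_int k'"
      "of_int N * h = of_int h'" "of_int N * g = of_int g'"
    using Ints by (metis Ints_cases insertCI)
  have "k' \<noteq> 0" using ints(2) N \<open>k \<noteq> 0\<close> by auto
  \<comment> \<open>\<open>U\<close> and \<open>W\<close> are the scaled unit vectors; making the
    coefficients of 1 and of \<alpha> vanish gives \<open>A\<close> and \<open>V\<close>.\<close>
  define A U V W :: "int ^ 2" where
    "A = vector [- l', - h']" "U = vector [N, 0]" "V = vector [- k', - g']" "W = vector [0, N]"
  have "zero_combination \<alpha> \<beta> A (A + U) (A + V) (A + U + V + W)"
  proof (rule zero_combination_edges)
    fix i :: 2
    have "\<alpha> * \<beta> * of_int N = of_int h' + \<alpha> * of_int g'"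
      unfolding hg(3) ints[symmetric] by (simp add: algebra_simps)
    moreover have "\<beta> * of_int N = of_int l' + \<alpha> * of_int k'"
      unfolding lk(3) ints[symmetric] by (simp add: algebra_simps)
    ultimately show "of_int (A $ i) + \<beta> * of_int (U $ i) + \<alpha> * of_int (V $ i)
        + \<alpha> * \<beta> * of_int (W $ i) = 0"
      using exhaust_2[of i] by (auto simp: A_U_V_W_def)
  qed
  moreover have "\<not> parallel_segments A (A + U) (A + V) (A + U + V + W)"
    "\<not> parallel_segments A (A + V) (A + U) (A + U + V + W)"
    using N \<open>k' \<noteq> 0\<close> by (simp_all add: parallel_segments_iff A_U_V_W_def algebra_simps)
  ultimately show ?thesis by blast
qed

theorem lemma6p3:
  fixes K :: "complex set" and \<alpha> \<beta> :: complex
  assumes "quadratic_number_field K" and "\<alpha> \<in> K" and "\<beta> \<in> K"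
  shows "(\<exists>A B C D :: int ^ 2. non_collinear A B C D \<and> zero_combination \<alpha> \<beta> A B C D) \<and>
    ((\<exists>A B C D :: int ^ 2. non_collinear A B C D \<and> zero_combination \<alpha> \<beta> A B C D \<and>
        \<not> parallel_segments A B C D \<and> \<not> parallel_segments A C B D)
      \<longleftrightarrow> (\<alpha> \<notin> \<rat> \<and> \<beta> \<notin> \<rat>) \<or> (\<alpha> \<in> \<rat> \<and> \<beta> \<in> \<rat>))"
    (is "?exists \<and> (?nonpar \<longleftrightarrow> ?same)")
proof (intro conjI iffI)
  have nonpar: ?nonpar if ?same
    using that both_rational_non_parallel both_irrational_non_parallel[OF assms] non_collinearI
    by meson
  then show ?nonpar if ?same using that .
  \<comment> \<open>If only \<alpha> is rational, AB and CD are parallel; if only \<beta> is, the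
    swap makes AC and BD parallel.\<close>
  show ?same if ?nonpar
    using that rational_irrational_parallel zero_combination_swap by blast
  show ?exists
  proof (cases ?same)
    case True
    then show ?thesis using nonpar by blast
  next
    case False
    then have "\<alpha> \<in> \<rat> \<or> \<beta> \<in> \<rat>" by blast
    then show ?thesis
      using rational_exists_non_collinear zero_combination_swap non_collinear_swap by meson
  qed
qed

end
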